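(* Let $k>2$ be an integer and let $X=\{(x,y,z)\in\mathbb{C}^3 : x^2+y^2=z^{2k}\}$ (a Brieskorn surface). Then the singularity of $X$ at $0\in\mathbb{C}^3$ is not strongly metrically conic.
   Context: Inner metric: for a connected set $Z$ (an algebraic set, its intersection with a ball, or a cone) in a Euclidean space, the inner distance $d(x,y)$ between $x,y\in Z$ is the infimum of the lengths of rectifiable arcs $\gamma:[0,1]\to Z$ with $\gamma(0)=x$, $\gamma(1)=y$. Strongly metrically conic: let $X\subset\mathbb{C}^n$ be an algebraic set and $x_0\in X$ a singular point. Let $B_\epsilon[x_0]$ and $S_\epsilon(x_0)$ be the closed ball and the sphere of radius $\epsilon$ centered at $x_0$ in $\mathbb{C}^n\cong\mathbb{R}^{2n}$, and let $c[X\cap S_\epsilon(x_0)]$ be the cone over $X\cap S_\epsilon(x_0)$ (the union of the straight segments joining $x_0$ to the points of $X\cap S_\epsilon(x_0)$). The point $x_0$ is a strongly metrically conic singular point of $X$ if for all sufficiently small $\epsilon>0$ there exists a semialgebraic homeomorphism $h:c[X\cap S_\epsilon(x_0)]\to X\cap B_\epsilon[x_0]$ which is bi-Lipschitz with respect to the inner metrics. (Semialgebraicity is understood after identifying $\mathbb{C}^n$ with $\mathbb{R}^{2n}$.) *)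

theory Defs
  imports "HOL-Analysis.Analysis"
begin

text \<open>
  On a finite-dimensional real space the predicate \<^const>\<open>real_polynomial_function\<close> describes
  exactly the real polynomials in the real coordinates. On \<^typ>\<open>complex ^ 'n\<close> these are the real
  and imaginary parts of the components, which gives the usual identification of complex
  \<open>n\<close>-space with real \<open>2n\<close>-space.
\<close>

inductive semialgebraic :: "'a::euclidean_space set \<Rightarrow> bool" where
  pos: "real_polynomial_function f \<Longrightarrow> semialgebraic {x. f x > 0}"
| union: "semialgebraic A \<Longrightarrow> semialgebraic B \<Longrightarrow> semialgebraic (A \<union> B)"
| inter: "semialgebraic A \<Longrightarrow> semialgebraic B \<Longrightarrow> semialgebraic (A \<inter> B)"
| compl: "semialgebraic A \<Longrightarrow> semialgebraic (- A)"

definition semialgebraic_on :: "'a::euclidean_space set \<Rightarrow> ('a \<Rightarrow> 'b::euclidean_space) \<Rightarrow> bool" where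
  "semialgebraic_on A f \<longleftrightarrow> semialgebraic {(x, f x) | x. x \<in> A}"

text \<open>
  The length is the supremum of the lengths of inscribed polygons. A subdivision is given by the
  first \<open>n + 1\<close> terms of a monotone sequence in the unit interval.
\<close>

definition path_length :: "(real \<Rightarrow> 'a::metric_space) \<Rightarrow> ennreal" where
  "path_length g =
     (SUP (n, t) \<in> {(n::nat, t :: nat \<Rightarrow> real). mono t \<and> range t \<subseteq> {0..1}}.
        \<Sum>i<n. ennreal (dist (g (t i)) (g (t (Suc i)))))"

definition rectifiable_path :: "(real \<Rightarrow> 'a::metric_space) \<Rightarrow> bool" where
  "rectifiable_path g \<longleftrightarrow> path g \<and> path_length g < \<infinity>"

text \<open>
  The arcs are not required to be injective, so that constant paths give distance \<open>0\<close> from a point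
  to itself. The value is \<open>\<infinity>\<close> if no rectifiable path in \<open>Z\<close> joins \<open>x\<close> to \<open>y\<close>.
\<close>

definition inner_distance :: "'a::metric_space set \<Rightarrow> 'a \<Rightarrow> 'a \<Rightarrow> ennreal" where
  "inner_distance Z x y =
     (INF g \<in> {g. rectifiable_path g \<and> path_image g \<subseteq> Z \<and> pathstart g = x \<and> pathfinish g = y}.
        path_length g)"

definition inner_bilipschitz_on :: "'a::metric_space set \<Rightarrow> 'b::metric_space set \<Rightarrow> ('a \<Rightarrow> 'b) \<Rightarrow> bool"
  where
  "inner_bilipschitz_on A B h \<longleftrightarrow>
     (\<exists>L::real. L > 0 \<and>
       (\<forall>x\<in>A. \<forall>y\<in>A.
          inner_distance B (h x) (h y) \<le> ennreal L * inner_distance A x y \<and>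
          inner_distance A x y \<le> ennreal L * inner_distance B (h x) (h y)))"

definition cone_over :: "'a::real_vector \<Rightarrow> 'a set \<Rightarrow> 'a set" where
  "cone_over x\<^sub>0 S = (\<Union>a\<in>S. closed_segment x\<^sub>0 a)"

definition strongly_metrically_conic :: "(complex ^ 'n) set \<Rightarrow> complex ^ 'n \<Rightarrow> bool" where
  "strongly_metrically_conic X x\<^sub>0 \<longleftrightarrow>
     (\<forall>\<^sub>F \<epsilon> in at_right 0.
        \<exists>h h'. homeomorphism (cone_over x\<^sub>0 (X \<inter> sphere x\<^sub>0 \<epsilon>)) (X \<inter> cball x\<^sub>0 \<epsilon>) h h' \<and>
               semialgebraic_on (cone_over x\<^sub>0 (X \<inter> sphere x\<^sub>0 \<epsilon>)) h \<and>
               inner_bilipschitz_on (cone_over x\<^sub>0 (X \<inter> sphere x\<^sub>0 \<epsilon>)) (X \<inter> cball x\<^sub>0 \<epsilon>) h)"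

text \<open>
  Holomorphy of maps in several variables, on open sets: real differentiability with
  complex-linear derivative.
\<close>

definition holomorphic_map_on :: "(complex ^ 'n) set \<Rightarrow> (complex ^ 'n \<Rightarrow> complex ^ 'm) \<Rightarrow> bool" where
  "holomorphic_map_on U f \<longleftrightarrow>
     (\<forall>x\<in>U. \<exists>f'. (f has_derivative f') (at x) \<and> (\<forall>c v. f' (c *s v) = c *s f' v))"

text \<open>
  A point of a complex algebraic set is singular if the set is not a complex submanifold near that
  point. \<^const>\<open>vec.subspace\<close> means complex linear subspace here.
\<close>

definition singular_point :: "(complex ^ 'n) set \<Rightarrow> complex ^ 'n \<Rightarrow> bool" where
  "singular_point X x\<^sub>0 \<longleftrightarrow> x\<^sub>0 \<in> X \<and>
     \<not> (\<exists>U V \<phi> \<psi> E. open U \<and> x\<^sub>0 \<in> U \<and> open V \<and> homeomorphism U V \<phi> \<psi> \<and>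
          holomorphic_map_on U \<phi> \<and> holomorphic_map_on V \<psi> \<and>
          vec.subspace (E :: (complex ^ 'n) set) \<and> \<phi> ` (X \<inter> U) = E \<inter> V)"

end

theory Submission
  imports Defs
begin

text \<open>
  Near \<open>0\<close> the surface contains, for each small \<open>t > 0\<close>, the circle of points
  \<open>(t\<^sup>k cos \<theta>, t\<^sup>k sin \<theta>, t)\<close>, whose length is of order \<open>t\<^sup>k\<close> although its distance from \<open>0\<close> is of
  order \<open>t\<close>. This circle is not null-homotopic in the surface minus \<open>0\<close>: put \<open>u = x + \<i>y\<close> and
  \<open>v = x - \<i>y\<close>, so that \<open>uv = (z\<^sup>k)\<^sup>2\<close>; the double covering \<open>(a, b) \<mapsto> (a\<^sup>2, b\<^sup>2, ab)\<close> of the punctured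
  quadric cone would otherwise give a continuous square root of \<open>u = t\<^sup>k e\<^bsup>\<i>\<theta>\<^esup>\<close>.

  Suppose that \<open>h\<close> is an inner bi-Lipschitz homeomorphism from the straight cone, and let
  \<open>p = h\<^sup>-\<^sup>1(0)\<close>. The cone minus its apex is covered by the open sectors
  \<open>Re (c(x \<plusminus> \<i>y)) > 0\<close>, each of which is homeomorphic to a convex set of dimension 4, so that a sector
  minus \<open>p\<close> is simply connected. For small \<open>t\<close> the preimage of the circle lies in one sector: by
  continuity if \<open>p\<close> is not the apex, and because its diameter is much smaller than its distance
  from the apex otherwise. This contradicts the non-triviality of the circle.

  The point \<open>0\<close> is singular because the curves in the surface through \<open>0\<close> have tangent vectors
  spanning the whole space, whereas the surface has empty interior.
\<close>

section \<open>The double covering of the punctured quadric cone\<close>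

definition veronese :: "complex \<times> complex \<Rightarrow> complex \<times> complex \<times> complex" where
  "veronese = (\<lambda>(a, b). (a\<^sup>2, b\<^sup>2, a * b))"

text \<open>The condition removes exactly the vertex, since \<open>u = v = 0\<close> forces
  \<open>w = 0\<close> on the quadric.\<close>

definition punctured_quadric :: "(complex \<times> complex \<times> complex) set" where
  "punctured_quadric = {(u, v, w). u * v = w\<^sup>2 \<and> (u \<noteq> 0 \<or> v \<noteq> 0)}"

lemma csqrt_eq_if_Re_pos:
  assumes "Re l > 0" shows "csqrt (l\<^sup>2) = l"
  using assms by (intro csqrt_square) auto

text \<open>
  The linear form \<open>l = \<alpha>a + \<beta>b\<close> satisfies \<open>l\<^sup>2 = N(a\<^sup>2, b\<^sup>2, ab)\<close>, and \<open>l a\<close>, \<open>l b\<close> are linear in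
  \<open>(a\<^sup>2, b\<^sup>2, ab)\<close>, so a choice of square root of \<open>N\<close> inverts the map.
\<close>

lemma veronese_local_inverse:
  fixes \<alpha> \<beta> s :: complex
  assumes s: "s\<^sup>2 = 1"
  defines "N \<equiv> \<lambda>(u, v, w). \<alpha>\<^sup>2 * u + 2 * \<alpha> * \<beta> * w + \<beta>\<^sup>2 * v"
  shows "homeomorphism {(a, b). 0 < Re ((\<alpha> * a + \<beta> * b)\<^sup>2) \<and> 0 < Re (s * (\<alpha> * a + \<beta> * b))}
           {p \<in> punctured_quadric. 0 < Re (N p)} veronese
           (\<lambda>(u, v, w). (s * (\<alpha> * u + \<beta> * w) / csqrt (N (u, v, w)),
                         s * (\<alpha> * w + \<beta> * v) / csqrt (N (u, v, w))))"
    (is "homeomorphism ?U ?T _ ?q")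
proof -
  have NV: "N (veronese (a, b)) = (\<alpha> * a + \<beta> * b)\<^sup>2" for a b
    by (simp add: N_def veronese_def power2_eq_square algebra_simps)
  have ss: "s * s = 1" using s by (simp add: power2_eq_square)
  have contN: "continuous_on ?T N"
    unfolding N_def case_prod_unfold by (intro continuous_intros)
  have contR: "continuous_on ?T (\<lambda>p. csqrt (N p))"
    by (rule continuous_on_compose2[OF continuous_on_csqrt contN])
       (auto simp: complex_nonpos_Reals_iff)
  have 1: "veronese (a, b) \<in> ?T \<and> ?q (veronese (a, b)) = (a, b)" if "(a, b) \<in> ?U" for a b
  proof -
    let ?l = "\<alpha> * a + \<beta> * b"
    have l: "Re (?l\<^sup>2) > 0" "Re (s * ?l) > 0" using that by auto
    then have l0: "?l \<noteq> 0" and ab: "a \<noteq> 0 \<or> b \<noteq> 0" by auto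
    have "csqrt ((s * ?l)\<^sup>2) = s * ?l" by (rule csqrt_eq_if_Re_pos) (use l in auto)
    then have r: "csqrt (N (veronese (a, b))) = s * ?l" by (simp add: NV power_mult_distrib s)
    have "s * (\<alpha> * a\<^sup>2 + \<beta> * (a * b)) = a * (s * ?l)" "s * (\<alpha> * (a * b) + \<beta> * b\<^sup>2) = b * (s * ?l)"
      by (simp_all add: power2_eq_square algebra_simps)
    moreover have "s * ?l \<noteq> 0" using l by auto
    ultimately have "?q (veronese (a, b)) = (a, b)"
      using r by (simp add: veronese_def)
    moreover have "veronese (a, b) \<in> punctured_quadric"
      using ab by (simp add: veronese_def punctured_quadric_def power_mult_distrib)
    ultimately show ?thesis using l by (simp add: NV)
  qed
  have 2: "?q (u, v, w) \<in> ?U \<and> veronese (?q (u, v, w)) = (u, v, w)" if "(u, v, w) \<in> ?T" for u v w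
  proof -
    let ?N = "N (u, v, w)"
    have uv: "u * v = w\<^sup>2" and N: "Re ?N > 0" using that by (auto simp: punctured_quadric_def)
    define r where "r = csqrt ?N"
    have r2: "r\<^sup>2 = ?N" by (simp add: r_def)
    \<comment> \<open>A positive real part of \<open>r\<^sup>2\<close> rules out
      \<open>Re r = 0\<close>, and the principal root has nonnegative real part.\<close>
    have "0 < (Re r)\<^sup>2 - (Im r)\<^sup>2" using N unfolding r2[symmetric] Re_power2 .
    then have "Re r \<noteq> 0" by auto
    then have r: "Re r > 0" using csqrt_principal[of ?N] by (auto simp: r_def)
    have r0: "r \<noteq> 0" using r by auto
    \<comment> \<open>These identities hold modulo \<open>u * v = w\<^sup>2\<close>: the numerators
      stand for l a and l b, and \<open>r\<^sup>2 = N\<close> stands for l^2.\<close>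
    have e1: "(\<alpha> * u + \<beta> * w)\<^sup>2 = u * r\<^sup>2" "(\<alpha> * w + \<beta> * v)\<^sup>2 = v * r\<^sup>2"
      "(\<alpha> * u + \<beta> * w) * (\<alpha> * w + \<beta> * v) = w * r\<^sup>2"
      unfolding r2 using uv unfolding N_def prod.case by algebra+
    have e4: "\<alpha> * (\<alpha> * u + \<beta> * w) + \<beta> * (\<alpha> * w + \<beta> * v) = r * r"
      unfolding power2_eq_square[of r, symmetric] r2
      by (simp add: N_def power2_eq_square algebra_simps)
    have e2: "\<alpha> * (s * (\<alpha> * u + \<beta> * w) / r) + \<beta> * (s * (\<alpha> * w + \<beta> * v) / r)
            = s * (\<alpha> * (\<alpha> * u + \<beta> * w) + \<beta> * (\<alpha> * w + \<beta> * v)) / r"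
      by (simp add: algebra_simps flip: add_divide_distrib)
    also have "\<dots> = s * r" unfolding e4 using r0 by simp
    finally have e3: "\<alpha> * (s * (\<alpha> * u + \<beta> * w) / r) + \<beta> * (s * (\<alpha> * w + \<beta> * v) / r) = s * r" .
    have "s * (s * r) = r" "(s * r)\<^sup>2 = ?N"
      using ss by (simp_all add: power_mult_distrib s r2 flip: mult.assoc)
    then have "?q (u, v, w) \<in> ?U"
      unfolding mem_Collect_eq prod.case r_def[symmetric] e3 using r N by (simp only: simp_thms)
    moreover have "veronese (?q (u, v, w)) = (u, v, w)"
    proof -
      have h: "(s * x / r) * (s * y / r) = x * y / r\<^sup>2" for x y
        using ss by (simp add: power2_eq_square field_simps)
      then have "veronese (s * x / r, s * y / r) = (x\<^sup>2 / r\<^sup>2, y\<^sup>2 / r\<^sup>2, x * y / r\<^sup>2)" for x y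
        by (simp only: veronese_def prod.case h power2_eq_square[of "s * x / r"]
            power2_eq_square[of "s * y / r"] power2_eq_square[of x] power2_eq_square[of y])
      then show ?thesis using e1 r0 by (simp add: r_def[symmetric])
    qed
    ultimately show ?thesis by blast
  qed
  have fwd: "veronese p \<in> ?T \<and> ?q (veronese p) = p" if "p \<in> ?U" for p
    using 1[of "fst p" "snd p"] that by (simp only: prod.collapse)
  have bwd: "?q p \<in> ?U \<and> veronese (?q p) = p" if "p \<in> ?T" for p
    using 2[of "fst p" "fst (snd p)" "snd (snd p)"] that by (simp only: prod.collapse)
  have c0: "csqrt (N p) \<noteq> 0" if "p \<in> ?T" for p using that by auto
  show ?thesis
  proof (rule homeomorphismI)
    show "continuous_on ?U veronese"
      unfolding veronese_def case_prod_unfold by (intro continuous_intros)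
    show "continuous_on ?T ?q"
      unfolding case_prod_unfold prod.collapse
      by (intro continuous_intros contR) (use c0 in auto)
    show "veronese ` ?U \<subseteq> ?T" by (rule image_subsetI) (rule fwd[THEN conjunct1])
    show "?q ` ?T \<subseteq> ?U" by (rule image_subsetI) (rule bwd[THEN conjunct1])
    show "?q (veronese p) = p" if "p \<in> ?U" for p using fwd[OF that] by (rule conjunct2)
    show "veronese (?q p) = p" if "p \<in> ?T" for p using bwd[OF that] by (rule conjunct2)
  qed
qed

text \<open>The fibres are the pairs (a, b), (-a, -b). Over the set Re N > 0 the linear form l with
  l^2 = N has nonzero real part, so the sign of Re l separates the two sheets.\<close>

lemma covering_space_veronese: "covering_space (UNIV - {0}) veronese punctured_quadric"
proof
  show "continuous_on (UNIV - {0}) veronese"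
    unfolding veronese_def case_prod_unfold by (intro continuous_intros)
  have "p \<in> veronese ` (UNIV - {0})" if "p \<in> punctured_quadric" for p
  proof -
    obtain u v w where p: "p = (u, v, w)" by (cases p)
    have uv: "u * v = w\<^sup>2" "u \<noteq> 0 \<or> v \<noteq> 0" using that by (auto simp: p punctured_quadric_def)
    show ?thesis
    proof (cases "u = 0")
      case True
      then have "p = veronese (0, csqrt v)" using uv by (auto simp: p veronese_def)
      then show ?thesis using uv True by (force simp: zero_prod_def)
    next
      case False
      then have "w\<^sup>2 / u = v" using uv by (simp add: field_simps)
      then have "p = veronese (csqrt u, w / csqrt u)"
        using False by (auto simp: p veronese_def power_divide)
      then show ?thesis using False by (force simp: zero_prod_def)
    qed
  qed
  then show veronese_onto: "veronese ` (UNIV - {0}) = punctured_quadric"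
    by (force simp: veronese_def punctured_quadric_def power_mult_distrib zero_prod_def)
  fix x assume "x \<in> punctured_quadric"
  then have "x \<in> veronese ` (UNIV - {0})" by (simp only: veronese_onto)
  then obtain a b where x: "x = veronese (a, b)" and ab: "a \<noteq> 0 \<or> b \<noteq> 0"
    by (auto simp: zero_prod_def)
  \<comment> \<open>With conjugate coefficients the form l takes the value |a|^2 + |b|^2 > 0 at (a,
    b), so x lies in the neighbourhood Re N > 0.\<close>
  define \<alpha> \<beta> where "\<alpha> = cnj a" and "\<beta> = cnj b"
  define N where "N = (\<lambda>(u, v, w). \<alpha>\<^sup>2 * u + 2 * \<alpha> * \<beta> * w + \<beta>\<^sup>2 * v)"
  define T where "T = {p \<in> punctured_quadric. 0 < Re (N p)}"
  define U where "U = (\<lambda>s. {(a, b). 0 < Re ((\<alpha> * a + \<beta> * b)\<^sup>2) \<and> 0 < Re (s * (\<alpha> * a + \<beta> * b))})"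
  have NV: "N (veronese (a, b)) = (\<alpha> * a + \<beta> * b)\<^sup>2" for a b
    by (simp add: N_def veronese_def power2_eq_square algebra_simps)
  have "\<alpha> * a + \<beta> * b = of_real ((cmod a)\<^sup>2 + (cmod b)\<^sup>2)"
    by (simp add: \<alpha>_def \<beta>_def complex_norm_square mult.commute flip: of_real_power)
  moreover have "(cmod a)\<^sup>2 + (cmod b)\<^sup>2 \<noteq> 0"
    using ab by (simp add: sum_power2_eq_zero_iff)
  ultimately have "Re (N x) > 0"
    by (simp add: x NV flip: of_real_power del: of_real_add)
  then have "x \<in> T" using \<open>x \<in> punctured_quadric\<close> by (simp add: T_def)
  moreover have "openin (top_of_set punctured_quadric) T"
  proof -
    have "open {p. 0 < Re (N p)}"
      unfolding N_def case_prod_unfold by (intro open_Collect_less continuous_intros)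
    then show ?thesis unfolding T_def by (auto simp: openin_open)
  qed
  moreover have "\<Union> {U 1, U (-1)} = (UNIV - {0}) \<inter> veronese -` T"
  proof -
    have "veronese p \<in> punctured_quadric \<longleftrightarrow> p \<noteq> 0" for p
      by (cases p) (auto simp: veronese_def punctured_quadric_def power_mult_distrib zero_prod_def)
    moreover have "Re l \<noteq> 0" if "Re (l\<^sup>2) > 0" for l
      using that by (auto simp: power2_eq_square)
    ultimately show ?thesis
      by (auto simp: U_def T_def NV simp del: Re_power2 neq0_conv; fastforce simp: zero_prod_def neq_iff simp del: Re_power2)
  qed
  moreover have "openin (top_of_set (UNIV - {0})) (U s)" for s
  proof -
    have "open (U s)" unfolding U_def case_prod_unfold Collect_conj_eq
      by (intro open_Int open_Collect_less continuous_intros)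
    moreover have "U s \<subseteq> UNIV - {0}" by (auto simp: U_def zero_prod_def)
    ultimately show ?thesis by (metis open_openin openin_subset_trans top_greatest subtopology_UNIV)
  qed
  moreover have "pairwise disjnt {U 1, U (-1)}"
    by (auto simp: pairwise_def disjnt_iff U_def)
  moreover have "\<exists>q. homeomorphism (U s) T veronese q" if "s\<^sup>2 = 1" for s
    using veronese_local_inverse[OF that, of \<alpha> \<beta>] unfolding U_def T_def N_def by blast
  ultimately show "\<exists>T. x \<in> T \<and> openin (top_of_set punctured_quadric) T \<and>
             (\<exists>v. \<Union> v = (UNIV - {0}) \<inter> veronese -` T \<and>
                  (\<forall>u\<in>v. openin (top_of_set (UNIV - {0})) u) \<and>
                  pairwise disjnt v \<and> (\<forall>u\<in>v. Ex (homeomorphism u T veronese)))"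
    by (intro exI[of _ T] conjI exI[of _ "{U 1, U (-1)}"]) auto
qed

text \<open>Dividing by the explicit root \<open>s 0 * cis (t / 2)\<close> leaves a continuous
  function with values in {1, -1}. It is therefore constant, yet it is 1 at 0 and -1 at 2 pi,
  because cis pi = -1.\<close>

lemma no_continuous_sqrt_on_circle:
  fixes s :: "real \<Rightarrow> complex" and r :: complex
  assumes cont: "continuous_on {0..2 * pi} s" and per: "s (2 * pi) = s 0"
    and sq: "\<And>t. t \<in> {0..2 * pi} \<Longrightarrow> (s t)\<^sup>2 = r * cis t" and r: "r \<noteq> 0"
  shows False
proof -
  have s0: "s 0 \<noteq> 0" using sq[of 0] r by auto
  define f where "f = (\<lambda>t. s t / (s 0 * cis (t / 2)))"
  have "f t = 1 \<or> f t = -1" if "t \<in> {0..2 * pi}" for t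
  proof -
    have "(cis (t / 2))\<^sup>2 = cis t" by (simp add: Complex.DeMoivre)
    moreover have "(s 0)\<^sup>2 = r" using sq[of 0] by simp
    ultimately have "(f t)\<^sup>2 = 1"
      using sq[OF that] r by (simp add: f_def power_divide power_mult_distrib)
    then show ?thesis by (simp add: power2_eq_1_iff)
  qed
  then have fin: "f ` {0..2 * pi} \<subseteq> {1, -1}" by blast
  have contf: "continuous_on {0..2 * pi} f"
    unfolding f_def using s0 by (intro continuous_intros cont) auto
  have "f constant_on {0..2 * pi}"
    using fin by (intro continuous_finite_range_constant contf finite_subset[OF fin]) auto
  moreover have "f 0 = 1" "f (2 * pi) = -1" using s0 per by (simp_all add: f_def)
  ultimately show False by (force simp: constant_on_def)
qed

section \<open>Charts of the cone over the link\<close>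

definition brieskorn :: "nat \<Rightarrow> (complex ^ 3) set" where
  "brieskorn k = {p. (p $ 1)\<^sup>2 + (p $ 2)\<^sup>2 = (p $ 3) ^ (2 * k)}"

text \<open>For \<open>\<sigma>\<^sup>2 = -1\<close> the branches of \<sigma> and -\<sigma> are the
  linear factors u, v of x^2 + y^2, so the surface reads u v = z^(2k). Keeping \<sigma> as a
  parameter lets one chart serve for both factors.\<close>

definition branch :: "complex \<Rightarrow> complex ^ 3 \<Rightarrow> complex" where
  "branch \<sigma> p = p $ 1 + \<sigma> * p $ 2"

definition of_branches :: "complex \<Rightarrow> complex \<Rightarrow> complex \<Rightarrow> complex \<Rightarrow> complex ^ 3" where
  "of_branches \<sigma> u v z = vector [(u + v) / 2, (u - v) / (2 * \<sigma>), z]"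

text \<open>The surface is quasi-homogeneous: this action multiplies both sides of its equation by
  t^(2k).\<close>

definition weighted :: "nat \<Rightarrow> real \<Rightarrow> complex ^ 3 \<Rightarrow> complex ^ 3" where
  "weighted k t p = vector [of_real (t ^ k) * p $ 1, of_real (t ^ k) * p $ 2, of_real t * p $ 3]"

lemma continuous_on_vector3 [continuous_intros]:
  fixes f g h :: "'a::topological_space \<Rightarrow> 'b::{topological_space,zero}"
  assumes "continuous_on S f" "continuous_on S g" "continuous_on S h"
  shows "continuous_on S (\<lambda>x. vector [f x, g x, h x] :: 'b ^ 3)"
proof -
  have "(\<lambda>x. vector [f x, g x, h x] :: 'b ^ 3)
      = (\<lambda>x. \<chi> i. if i = 1 then f x else if i = 2 then g x else h x)"
    by (simp add: fun_eq_iff vec_eq_iff forall_3)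
  moreover have "continuous_on S (\<lambda>x. if i = 1 then f x else if i = 2 then g x else h x)" for i :: 3
    using assms by (cases "i = 1"; cases "i = 2") simp_all
  ultimately show ?thesis by (simp only:) (intro continuous_on_vec_lambda)
qed

lemma continuous_on_branch [continuous_intros]:
  "continuous_on S f \<Longrightarrow> continuous_on S (\<lambda>x. branch \<sigma> (f x))"
  unfolding branch_def by (intro continuous_intros)

lemma branch_0 [simp]: "branch \<sigma> 0 = 0"
  by (simp add: branch_def)

lemma branch_scaleR: "branch \<sigma> (r *\<^sub>R p) = of_real r * branch \<sigma> p"
  by (simp only: branch_def vector_scaleR_component) (simp add: scaleR_conv_of_real algebra_simps)

lemma branch_diff: "branch \<sigma> (p - q) = branch \<sigma> p - branch \<sigma> q"
  by (simp add: branch_def algebra_simps)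

lemma branch_weighted: "branch \<sigma> (weighted k t p) = of_real (t ^ k) * branch \<sigma> p"
  by (simp add: branch_def weighted_def algebra_simps)

lemma weighted_3: "weighted k t p $ 3 = of_real t * p $ 3"
  by (simp add: weighted_def)

lemma branch_mult: "\<sigma>\<^sup>2 = -1 \<Longrightarrow> branch \<sigma> p * branch (-\<sigma>) p = (p $ 1)\<^sup>2 + (p $ 2)\<^sup>2"
  unfolding branch_def by algebra

lemma branch_of_branches:
  assumes "\<sigma>\<^sup>2 = -1"
  shows "branch \<sigma> (of_branches \<sigma> u v z) = u" "branch (-\<sigma>) (of_branches \<sigma> u v z) = v"
    "of_branches \<sigma> u v z $ 3 = z"
proof -
  have "\<sigma> \<noteq> 0" using assms by auto
  then show "branch \<sigma> (of_branches \<sigma> u v z) = u" "branch (-\<sigma>) (of_branches \<sigma> u v z) = v"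
    "of_branches \<sigma> u v z $ 3 = z"
    by (auto simp: branch_def of_branches_def field_simps)
qed

lemma vec3_eq_branches:
  assumes "\<sigma>\<^sup>2 = -1" "branch \<sigma> p = branch \<sigma> q" "branch (-\<sigma>) p = branch (-\<sigma>) q" "p $ 3 = q $ 3"
  shows "p = q"
proof -
  have s0: "\<sigma> \<noteq> 0" using assms by auto
  have "2 * p $ 1 = 2 * q $ 1"
    using arg_cong2[OF assms(2,3), of "(+)"] by (simp add: branch_def)
  then have 1: "p $ 1 = q $ 1" by simp
  then have "p $ 2 = q $ 2" using assms(2) s0 by (simp add: branch_def)
  with 1 assms(4) show ?thesis by (simp add: vec_eq_iff forall_3)
qed

lemma norm_vec3: "(norm (p :: complex ^ 3))\<^sup>2 = (cmod (p $ 1))\<^sup>2 + (cmod (p $ 2))\<^sup>2 + (cmod (p $ 3))\<^sup>2"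
  by (simp add: norm_vec_def L2_set_def sum_3)

lemma norm_branch_le:
  assumes "\<sigma>\<^sup>2 = -1" shows "cmod (branch \<sigma> p) \<le> 2 * norm p"
proof -
  have "cmod \<sigma> = 1" using arg_cong[OF assms, of cmod] by (simp add: norm_power power2_eq_1_iff)
      (metis norm_ge_zero le_minus_one_simps(3))
  then have "cmod (branch \<sigma> p) \<le> cmod (p $ 1) + cmod (p $ 2)"
    unfolding branch_def using norm_triangle_ineq[of "p $ 1" "\<sigma> * p $ 2"] by (simp add: norm_mult)
  also have "\<dots> \<le> 2 * norm p" using Finite_Cartesian_Product.norm_nth_le[of p 1] Finite_Cartesian_Product.norm_nth_le[of p 2] by linarith
  finally show ?thesis .
qed

lemma brieskorn_iff: "\<sigma>\<^sup>2 = -1 \<Longrightarrow> p \<in> brieskorn k \<longleftrightarrow> branch \<sigma> p * branch (-\<sigma>) p = (p $ 3) ^ (2 * k)"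
  by (simp add: brieskorn_def branch_mult)

lemma branch_nonzero:
  assumes "\<sigma>\<^sup>2 = -1" "p \<in> brieskorn k" "p \<noteq> 0" "k > 0"
  shows "branch \<sigma> p \<noteq> 0 \<or> branch (-\<sigma>) p \<noteq> 0"
proof (rule ccontr)
  assume *: "\<not> ?thesis"
  then have "p $ 3 = 0" using assms by (simp add: brieskorn_iff)
  with * have "p = 0" by (intro vec3_eq_branches[OF assms(1)]) simp_all
  with assms show False by simp
qed

section \<open>Orbits of the weighted action and the sphere\<close>

lemma weighted_brieskorn: "p \<in> brieskorn k \<Longrightarrow> weighted k t p \<in> brieskorn k"
  by (simp add: brieskorn_def weighted_def power_mult_distrib power_mult mult.commute[of 2 k]
      flip: distrib_left)

lemma norm_weighted:
  "(norm (weighted k t p))\<^sup>2 = ((cmod (p $ 1))\<^sup>2 + (cmod (p $ 2))\<^sup>2) * (t\<^sup>2) ^ k + (cmod (p $ 3))\<^sup>2 * t\<^sup>2"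
proof -
  have "(t ^ k)\<^sup>2 = (t\<^sup>2) ^ k" by (simp add: mult.commute flip: power_mult)
  then show ?thesis
    by (simp add: norm_vec3 weighted_def norm_mult power_mult_distrib algebra_simps del: of_real_power)
qed

lemma norm_weighted_strict_mono:
  assumes "p $ 1 \<noteq> 0 \<or> p $ 2 \<noteq> 0" "0 < k" "0 \<le> s" "s < t"
  shows "norm (weighted k s p) < norm (weighted k t p)"
proof -
  have st: "s\<^sup>2 < t\<^sup>2" using assms by (intro power_strict_mono) auto
  have "(s\<^sup>2) ^ k < (t\<^sup>2) ^ k" using st assms by (intro power_strict_mono) auto
  moreover have "0 < (cmod (p $ 1))\<^sup>2 + (cmod (p $ 2))\<^sup>2"
    using assms(1) by (auto simp: sum_power2_gt_zero_iff)
  ultimately have "(norm (weighted k s p))\<^sup>2 < (norm (weighted k t p))\<^sup>2"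
    unfolding norm_weighted using st
    by (intro add_less_le_mono mult_strict_left_mono mult_left_mono) auto
  then show ?thesis by (rule power_less_imp_less_base) simp
qed

text \<open>Along an orbit off the third axis the norm starts at 0, increases strictly and is
  unbounded; the intermediate value theorem gives existence and monotonicity gives
  uniqueness.\<close>

lemma weighted_reaches_sphere:
  assumes p: "p $ 1 \<noteq> 0 \<or> p $ 2 \<noteq> 0" and k: "0 < k" and e: "0 < \<epsilon>"
  shows "\<exists>!t. 0 < t \<and> norm (weighted k t p) = \<epsilon>"
proof -
  define A where "A = (cmod (p $ 1))\<^sup>2 + (cmod (p $ 2))\<^sup>2"
  have A: "0 < A" using p by (auto simp: A_def sum_power2_gt_zero_iff)
  \<comment> \<open>The maximum with 1 ensures \<open>T \<le> T ^ (2 * k)\<close>, so the first two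
    coordinates alone already reach norm \<epsilon> at time T.\<close>
  define T where "T = max 1 (\<epsilon>\<^sup>2 / A)"
  have T: "1 \<le> T" "\<epsilon>\<^sup>2 \<le> A * T" using A by (auto simp: T_def field_simps max_def)
  have "T \<le> (T\<^sup>2) ^ k" using T k self_le_power[of T "2 * k"] by (simp add: power_mult)
  then have "\<epsilon>\<^sup>2 \<le> A * (T\<^sup>2) ^ k" using T A by (meson mult_left_mono order_trans less_imp_le)
  also have "\<dots> \<le> (norm (weighted k T p))\<^sup>2" unfolding norm_weighted A_def[symmetric] by simp
  finally have "\<epsilon> \<le> norm (weighted k T p)" by (rule power2_le_imp_le) simp
  moreover have "weighted k 0 p = 0" using k by (simp add: weighted_def vec_eq_iff forall_3)
  moreover have "continuous_on {0..T} (\<lambda>t. norm (weighted k t p))"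
    unfolding weighted_def by (intro continuous_intros)
  ultimately obtain t where t: "0 \<le> t" "norm (weighted k t p) = \<epsilon>"
    using IVT'[of "\<lambda>t. norm (weighted k t p)" 0 \<epsilon> T] e T by auto
  with \<open>weighted k 0 p = 0\<close> e have "t > 0" by (cases "t = 0") auto
  moreover have "s = t" if "0 < s" "norm (weighted k s p) = \<epsilon>" for s
    using norm_weighted_strict_mono[OF p k, of s t] norm_weighted_strict_mono[OF p k, of t s] that t
    by (cases s t rule: linorder_cases) auto
  ultimately show ?thesis using t by blast
qed

text \<open>For b slightly below \<open>\<tau> x\<close> one has \<open>F x b < c\<close>.
  Continuity in x at the fixed time b carries this to nearby y, and monotonicity then forces
  \<open>\<tau> y > b\<close>; the upper bound is symmetric.\<close>

lemma continuous_on_level_of_increasing: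
  fixes F :: "'a::topological_space \<Rightarrow> real \<Rightarrow> real"
  assumes cont: "\<And>t. 0 < t \<Longrightarrow> continuous_on S (\<lambda>x. F x t)"
    and mono: "\<And>x s t. x \<in> S \<Longrightarrow> 0 < s \<Longrightarrow> s < t \<Longrightarrow> F x s < F x t"
    and \<tau>: "\<And>x. x \<in> S \<Longrightarrow> 0 < \<tau> x \<and> F x (\<tau> x) = c"
  shows "continuous_on S \<tau>"
  unfolding continuous_on_def
proof (intro ballI order_tendstoI)
  fix x a assume x: "x \<in> S" and a: "a < \<tau> x"
  \<comment> \<open>The maximum with \<open>\<tau> x / 2\<close> keeps b positive, where F is known
    to be increasing.\<close>
  define b where "b = max a (\<tau> x / 2)"
  have b: "0 < b" "b < \<tau> x" "a \<le> b" using a \<tau>[OF x] by (auto simp: b_def)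
  have "F x b < c" using mono[OF x b(1,2)] \<tau>[OF x] by simp
  then have "eventually (\<lambda>y. F y b < c) (at x within S)"
    using cont[OF b(1)] x by (auto simp: continuous_on_def intro: order_tendstoD)
  moreover have "eventually (\<lambda>y. y \<in> S) (at x within S)" by (simp add: eventually_at_filter)
  ultimately show "eventually (\<lambda>y. a < \<tau> y) (at x within S)"
  proof eventually_elim
    case (elim y)
    then show ?case using \<tau>[of y] mono[of y "\<tau> y" b] b
      by (cases "\<tau> y" b rule: linorder_cases) auto
  qed
next
  fix x a assume x: "x \<in> S" and a: "\<tau> x < a"
  have "0 < a" "c < F x a" using mono[OF x _ a] \<tau>[OF x] a by auto
  then have "eventually (\<lambda>y. c < F y a) (at x within S)"
    using cont[of a] x by (auto simp: continuous_on_def intro: order_tendstoD)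
  moreover have "eventually (\<lambda>y. y \<in> S) (at x within S)" by (simp add: eventually_at_filter)
  ultimately show "eventually (\<lambda>y. \<tau> y < a) (at x within S)"
  proof eventually_elim
    case (elim y)
    then show ?case using \<tau>[of y] mono[of y a "\<tau> y"] \<open>0 < a\<close>
      by (cases "\<tau> y" a rule: linorder_cases) auto
  qed
qed

section \<open>The straight cone over the link and its sectors\<close>

lemma cone_over_sphere_iff:
  fixes X :: "'a::real_normed_vector set"
  assumes "0 < \<epsilon>" "p \<noteq> 0"
  shows "p \<in> cone_over 0 (X \<inter> sphere 0 \<epsilon>) \<longleftrightarrow> norm p \<le> \<epsilon> \<and> (\<epsilon> / norm p) *\<^sub>R p \<in> X"
proof
  assume "p \<in> cone_over 0 (X \<inter> sphere 0 \<epsilon>)"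
  then obtain m l where "m \<in> X" "norm m = \<epsilon>" "0 \<le> l" "l \<le> 1" "p = l *\<^sub>R m"
    by (auto simp: cone_over_def in_segment)
  with assms show "norm p \<le> \<epsilon> \<and> (\<epsilon> / norm p) *\<^sub>R p \<in> X"
    by (auto simp: mult_left_le_one_le)
next
  assume *: "norm p \<le> \<epsilon> \<and> (\<epsilon> / norm p) *\<^sub>R p \<in> X"
  have "p = (norm p / \<epsilon>) *\<^sub>R ((\<epsilon> / norm p) *\<^sub>R p)" using assms by simp
  moreover have "norm ((\<epsilon> / norm p) *\<^sub>R p) = \<epsilon>" using assms by simp
  ultimately show "p \<in> cone_over 0 (X \<inter> sphere 0 \<epsilon>)"
    unfolding cone_over_def using * assms
    by (intro UN_I[of "(\<epsilon> / norm p) *\<^sub>R p"]) (auto simp: in_segment intro!: exI[of _ "norm p / \<epsilon>"])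
qed

text \<open>
  On the sphere the weighted action of the positive reals allows one to normalise
  \<open>Re (c u) = 1\<close>, where \<open>u\<close> is the branch of \<open>\<sigma>\<close>; the surface is then parametrised by \<open>Im (c u)\<close> and the
  third coordinate. The last coordinate of the chart is the cone parameter.
\<close>

lemma cone_chart:
  fixes \<sigma> c :: complex
  assumes s: "\<sigma>\<^sup>2 = -1" and c: "c \<noteq> 0" and k: "0 < k" and e: "0 < \<epsilon>"
  shows "{p \<in> cone_over 0 (brieskorn k \<inter> sphere 0 \<epsilon>). 0 < Re (c * branch \<sigma> p)} homeomorphic
         ((UNIV \<times> UNIV \<times> {0<..1}) :: (real \<times> complex \<times> real) set)"
proof -
  let ?C = "cone_over 0 (brieskorn k \<inter> sphere 0 \<epsilon>)"
  let ?W = "{p \<in> ?C. 0 < Re (c * branch \<sigma> p)}"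
  let ?Q = "(UNIV \<times> UNIV \<times> {0<..1}) :: (real \<times> complex \<times> real) set"
  \<comment> \<open>\<open>E x\<close> is the value u of the branch with c u = 1 + \<i> x.\<close>
  define E where "E x = Complex 1 x / c" for x
  have E0: "E x \<noteq> 0" for x using c by (simp add: E_def) (simp add: complex_eq_iff)
  have contE: "continuous_on S (\<lambda>y. E (f y))" if "continuous_on S f" for S :: "'z::topological_space set" and f
    unfolding E_def using c that by (intro continuous_intros) (auto simp: Complex_eq intro!: continuous_intros)
  \<comment> \<open>The point of the surface with u = \<open>E x\<close> and third coordinate
    \<zeta>; since u is nonzero, the equation determines v.\<close>
  define base where "base = (\<lambda>(x, \<zeta>). of_branches \<sigma> (E x) (\<zeta> ^ (2 * k) / E x) \<zeta>)"
  have base: "branch \<sigma> (base (x, \<zeta>)) = E x" "branch (-\<sigma>) (base (x, \<zeta>)) = \<zeta> ^ (2 * k) / E x"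
    "base (x, \<zeta>) $ 3 = \<zeta>" for x \<zeta>
    by (simp_all add: base_def branch_of_branches s)
  have baseX: "base q \<in> brieskorn k" for q
    by (cases q) (simp add: brieskorn_iff[OF s] base E0)
  have base0: "base q $ 1 \<noteq> 0 \<or> base q $ 2 \<noteq> 0" for q
    using E0[of "fst q"] base(1)[of "fst q" "snd q"] by (auto simp: branch_def)
  have cont_base: "continuous_on UNIV base"
    unfolding base_def of_branches_def case_prod_unfold using s E0
    by (intro continuous_intros contE) auto
  define \<tau> where "\<tau> q = (THE t. 0 < t \<and> norm (weighted k t (base q)) = \<epsilon>)" for q
  have \<tau>: "0 < \<tau> q \<and> norm (weighted k (\<tau> q) (base q)) = \<epsilon>" for q
    unfolding \<tau>_def by (rule theI'[OF weighted_reaches_sphere[OF base0 k e]])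
  have \<tau>_eq: "\<tau> q = t" if "0 < t" "norm (weighted k t (base q)) = \<epsilon>" for q t
    using weighted_reaches_sphere[OF base0 k e, of q] \<tau>[of q] that by blast
  have cont_\<tau>: "continuous_on UNIV \<tau>"
  proof (rule continuous_on_level_of_increasing[where F = "\<lambda>q t. norm (weighted k t (base q))" and c = \<epsilon>])
    show "continuous_on UNIV (\<lambda>q. norm (weighted k t (base q)))" for t
      unfolding weighted_def by (intro continuous_intros cont_base)
  qed (use \<tau> norm_weighted_strict_mono[OF base0 k] in auto)
  \<comment> \<open>Let m be the radial projection of p to the sphere and t^k = Re (c u(m)). Undoing
    the scaling by t turns m into a base point: the ratio Im / Re is invariant under both scalings,
    and \<zeta> is the third coordinate of m divided by t.\<close>
  define f where "f p = (Im (c * branch \<sigma> p) / Re (c * branch \<sigma> p),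
      of_real (\<epsilon> / norm p) * p $ 3 / of_real (root k (Re (c * branch \<sigma> ((\<epsilon> / norm p) *\<^sub>R p)))), norm p / \<epsilon>)" for p
  define g where "g = (\<lambda>(x, \<zeta>, l). l *\<^sub>R weighted k (\<tau> (x, \<zeta>)) (base (x, \<zeta>)))"
  have W0: "p \<noteq> 0" if "p \<in> ?W" for p using that by (auto simp: branch_def)
  have 1: "f p \<in> ?Q \<and> g (f p) = p" if p: "p \<in> ?W" for p
  proof -
    define m where "m = (\<epsilon> / norm p) *\<^sub>R p"
    note p0 = W0[OF p]
    have mX: "m \<in> brieskorn k" and pe: "norm p \<le> \<epsilon>"
      using p cone_over_sphere_iff[OF e p0] by (auto simp: m_def)
    have nm: "norm m = \<epsilon>" using e p0 by (simp add: m_def)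
    have bm: "c * branch \<sigma> m = of_real (\<epsilon> / norm p) * (c * branch \<sigma> p)"
      by (simp add: m_def branch_scaleR)
    define r where "r = Re (c * branch \<sigma> m)"
    have r: "r > 0" using p p0 e by (simp add: r_def bm)
    define t where "t = root k r"
    have t: "0 < t" "t ^ k = r" using r k by (simp_all add: t_def)
    have m0: "branch \<sigma> m \<noteq> 0" using r by (auto simp: r_def)
    have m3: "of_real (\<epsilon> / norm p) * p $ 3 = m $ 3"
      by (simp only: m_def vector_scaleR_component) (simp only: scaleR_conv_of_real)
    define x where "x = Im (c * branch \<sigma> p) / Re (c * branch \<sigma> p)"
    have x: "x = Im (c * branch \<sigma> m) / r" unfolding r_def bm x_def using e p0 by simp
    have fp: "f p = (x, m $ 3 / of_real t, norm p / \<epsilon>)"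
      by (simp only: f_def m3 x_def m_def[symmetric] r_def[symmetric] t_def[symmetric])
    have Ex: "E x = branch \<sigma> m / of_real r"
    proof -
      have "Complex 1 x = c * branch \<sigma> m / of_real r"
        using r by (simp add: complex_eq_iff x) (simp add: r_def)
      then show ?thesis using c by (simp add: E_def)
    qed
    \<comment> \<open>Because \<open>t ^ k = r\<close>, dividing the equation of m by r^2 shows that
      the base point has second factor v(m) / r.\<close>
    have "(m $ 3 / of_real t) ^ (2 * k) = m $ 3 ^ (2 * k) / (of_real r)\<^sup>2"
      using t by (simp add: power_divide mult.commute[of 2] power_mult flip: of_real_power)
    also have "\<dots> = branch \<sigma> m * branch (-\<sigma>) m / (of_real r)\<^sup>2"
      using mX by (simp add: brieskorn_iff[OF s])
    finally have z: "(m $ 3 / of_real t) ^ (2 * k) = branch \<sigma> m * branch (-\<sigma>) m / (of_real r)\<^sup>2" .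
    have z: "(m $ 3 / of_real t) ^ (2 * k) / E x = branch (-\<sigma>) m / of_real r"
      unfolding z Ex using m0 r by (simp add: field_simps power2_eq_square)
    have wm: "weighted k t (base (x, m $ 3 / of_real t)) = m"
      using t r by (intro vec3_eq_branches[OF s])
        (simp_all only: branch_weighted weighted_3 base z, simp_all add: Ex)
    then have "\<tau> (x, m $ 3 / of_real t) = t" using t nm by (intro \<tau>_eq) auto
    then have "g (f p) = p" using p0 e by (simp add: fp g_def wm) (simp add: m_def)
    then show ?thesis using p0 pe e by (auto simp: fp)
  qed
  have 2: "g (x, \<zeta>, l) \<in> ?W \<and> f (g (x, \<zeta>, l)) = (x, \<zeta>, l)" if "0 < l" "l \<le> 1" for x \<zeta> l
  proof -
    define t where "t = \<tau> (x, \<zeta>)"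
    define m where "m = weighted k t (base (x, \<zeta>))"
    have t: "t > 0" and nm: "norm m = \<epsilon>" using \<tau> by (auto simp: t_def m_def)
    have mX: "m \<in> brieskorn k" by (simp add: m_def weighted_brieskorn baseX)
    have gp: "g (x, \<zeta>, l) = l *\<^sub>R m" by (simp add: g_def m_def t_def)
    have np: "norm (l *\<^sub>R m) = l * \<epsilon>" using that nm by simp
    have mp: "(\<epsilon> / (l * \<epsilon>)) *\<^sub>R (l *\<^sub>R m) = m" using that e by simp
    have bm: "c * branch \<sigma> m = of_real (t ^ k) * Complex 1 x"
      using c by (simp add: m_def branch_weighted base E_def)
    have bp: "c * branch \<sigma> (l *\<^sub>R m) = of_real (l * t ^ k) * Complex 1 x"
      using bm by (simp add: branch_scaleR algebra_simps)
    have pC: "l *\<^sub>R m \<in> ?C"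
      using cone_over_sphere_iff[OF e, of "l *\<^sub>R m" "brieskorn k"] that nm e mX by (auto simp: np)
    have "f (l *\<^sub>R m) = (x, m $ 3 / of_real t, l)"
      unfolding f_def np mp bp bm vector_scaleR_component using that t k e
      by (simp add: real_root_power_cancel scaleR_conv_of_real)
    moreover have "m $ 3 = of_real t * \<zeta>" by (simp add: m_def weighted_3 base)
    moreover have "0 < Re (c * branch \<sigma> (l *\<^sub>R m))" unfolding bp using t that by simp
    ultimately show ?thesis unfolding gp using pC t by (simp del: times_complex.sel)
  qed
  have bwd: "g q \<in> ?W \<and> f (g q) = q" if "q \<in> ?Q" for q
    using 2[of "snd (snd q)" "fst q" "fst (snd q)"] that by (simp add: mem_Times_iff)
  have "homeomorphism ?W ?Q f g"
  proof (rule homeomorphismI)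
    have pos: "0 < Re (c * branch \<sigma> ((\<epsilon> / norm p) *\<^sub>R p))" if "p \<in> ?W" for p
      using that W0[OF that] e by (simp add: branch_scaleR mult.left_commute[of c])
    have nz: "\<forall>p\<in>?W. Re (c * branch \<sigma> p) \<noteq> 0" "\<forall>p\<in>?W. norm p \<noteq> 0"
      using W0 by auto
    have nz_root: "\<forall>p\<in>?W. complex_of_real (root k (Re (c * branch \<sigma> ((\<epsilon> / norm p) *\<^sub>R p)))) \<noteq> 0"
    proof
      fix p assume "p \<in> ?W"
      then have "0 < root k (Re (c * branch \<sigma> ((\<epsilon> / norm p) *\<^sub>R p)))"
        by (rule real_root_gt_zero[OF k pos])
      then show "complex_of_real (root k (Re (c * branch \<sigma> ((\<epsilon> / norm p) *\<^sub>R p)))) \<noteq> 0"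
        unfolding of_real_eq_0_iff by linarith
    qed
    show "continuous_on ?W f"
      unfolding f_def by (intro continuous_intros nz nz_root) (use e in simp)
    show "continuous_on ?Q g"
      unfolding g_def case_prod_unfold weighted_def
      by (intro continuous_intros continuous_on_compose2[OF cont_\<tau>] continuous_on_compose2[OF cont_base]) auto
  qed (use 1 bwd in blast)+
  then show ?thesis by (auto simp: homeomorphic_def)
qed

text \<open>A convex set of dimension at least 3 stays simply connected when a point is removed. The
  point may also lie outside S, as the preimage of 0 need not belong to the chosen sector.\<close>

lemma punctured_homeomorphic_convex:
  fixes S :: "'a::metric_space set" and T :: "'b::euclidean_space set"
  assumes ST: "S homeomorphic T" and T: "convex T" "3 \<le> aff_dim T"
  shows "simply_connected (S - {a})" "locally path_connected (S - {a})"
proof -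
  have "simply_connected (S - {a}) \<and> locally path_connected (S - {a})"
  proof (cases "a \<in> S")
    case True
    from ST obtain f g where fg: "homeomorphism S T f g" by (auto simp: homeomorphic_def)
    then have "f ` S = T" "inj_on f S"
      by (auto simp: homeomorphism_def intro: inj_on_inverseI)
    then have "f ` (S - {a}) = T - {f a}"
      using True by (simp add: inj_on_image_set_diff[of f S])
    then have "homeomorphism (S - {a}) (T - {f a}) f g"
      by (intro homeomorphism_of_subsets[OF fg]) auto
    then have hom: "(S - {a}) homeomorphic (T - {f a})" by (auto simp: homeomorphic_def)
    have "locally path_connected (T - {f a})"
      using convex_imp_locally_path_connected[OF T(1)]
      by (rule locally_open_subset) (simp add: openin_delete)
    then show ?thesis
      using simply_connected_punctured_convex[OF T] homeomorphic_simply_connected_eq[OF hom]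
        homeomorphic_locally[where P = path_connected and Q = path_connected, OF hom homeomorphic_path_connectedness]
      by blast
  next
    case False
    then show ?thesis
      using convex_imp_simply_connected[OF T(1)] homeomorphic_simply_connected_eq[OF ST]
        convex_imp_locally_path_connected[OF T(1)]
        homeomorphic_locally[where P = path_connected and Q = path_connected, OF ST homeomorphic_path_connectedness]
      by simp
  qed
  then show "simply_connected (S - {a})" "locally path_connected (S - {a})" by blast+
qed

lemma aff_dim_chart: "aff_dim ((UNIV \<times> UNIV \<times> {0<..1}) :: (real \<times> complex \<times> real) set) = 4"
proof -
  have "interior ((UNIV \<times> UNIV \<times> {0<..1}) :: (real \<times> complex \<times> real) set) \<noteq> {}"
    unfolding interior_Times by auto
  then show ?thesis by (simp add: aff_dim_nonempty_interior)
qed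

section \<open>The inner metric\<close>

lemma dist_le_path_length: "ennreal (dist (g 0) (g 1)) \<le> path_length g"
proof -
  define t where "t = (\<lambda>i::nat. if i = 0 then 0 else 1 :: real)"
  have "mono t" "range t \<subseteq> {0..1}" by (auto simp: t_def mono_def)
  then have "(\<Sum>i<1. ennreal (dist (g (t i)) (g (t (Suc i))))) \<le> path_length g"
    unfolding path_length_def by (intro SUP_upper2[of "(1, t)"]) auto
  then show ?thesis by (simp add: t_def)
qed

lemma dist_le_inner_distance: "ennreal (dist x y) \<le> inner_distance Z x y"
  unfolding inner_distance_def
  by (intro INF_greatest) (use dist_le_path_length in \<open>auto simp: pathstart_def pathfinish_def\<close>)

text \<open>Along a monotone subdivision the bounds telescope to \<open>B * (t n - t 0)\<close>, and
  both times lie in the unit interval.\<close>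

lemma path_length_le_lipschitz:
  fixes g :: "real \<Rightarrow> 'a::metric_space"
  assumes "B-lipschitz_on {0..1} g"
  shows "path_length g \<le> ennreal B"
  unfolding path_length_def
proof (intro SUP_least, clarify)
  fix n and t :: "nat \<Rightarrow> real"
  assume t: "mono t" "range t \<subseteq> {0..1}"
  have t01: "t i \<in> {0..1}" for i using t(2) by blast
  have B: "0 \<le> B" using assms by (rule lipschitz_on_nonneg)
  have "(\<Sum>i<n. ennreal (dist (g (t i)) (g (t (Suc i))))) = ennreal (\<Sum>i<n. dist (g (t i)) (g (t (Suc i))))"
    by simp
  also have "(\<Sum>i<n. dist (g (t i)) (g (t (Suc i)))) \<le> (\<Sum>i<n. B * (t (Suc i) - t i))"
  proof (rule sum_mono)
    fix i
    have "dist (t i) (t (Suc i)) = t (Suc i) - t i"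
      using monoD[OF t(1), of i "Suc i"] by (simp add: dist_real_def)
    then show "dist (g (t i)) (g (t (Suc i))) \<le> B * (t (Suc i) - t i)"
      using lipschitz_onD[OF assms t01 t01, of i "Suc i"] by simp
  qed
  also have "\<dots> = B * (t n - t 0)" by (simp add: sum_lessThan_telescope flip: sum_distrib_left)
  also have "\<dots> \<le> B" using B t01[of n] t01[of 0] by (intro mult_left_le) auto
  finally show "(\<Sum>i<n. ennreal (dist (g (t i)) (g (t (Suc i))))) \<le> ennreal B"
    by (simp add: ennreal_leI)
qed

lemma inner_distance_le_lipschitz:
  fixes g :: "real \<Rightarrow> 'a::metric_space"
  assumes "B-lipschitz_on {0..1} g" "g ` {0..1} \<subseteq> Z"
  shows "inner_distance Z (g 0) (g 1) \<le> ennreal B"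
proof -
  note le = path_length_le_lipschitz[OF assms(1)]
  have "rectifiable_path g"
    using lipschitz_on_continuous_on[OF assms(1)] le
    by (auto simp: rectifiable_path_def path_def intro: le_less_trans)
  then have "inner_distance Z (g 0) (g 1) \<le> path_length g"
    unfolding inner_distance_def
    by (intro INF_lower) (use assms in \<open>auto simp: pathstart_def pathfinish_def path_image_def\<close>)
  with le show ?thesis by order
qed

text \<open>The segment from the apex to p stays in the cone. This later bounds the norm of a
  preimage from below.\<close>

lemma inner_distance_apex_le:
  fixes S :: "'a::real_normed_vector set"
  assumes "p \<in> cone_over 0 S"
  shows "inner_distance (cone_over 0 S) 0 p \<le> ennreal (norm p)"
proof -
  obtain m l where m: "m \<in> S" "0 \<le> l" "l \<le> 1" "p = l *\<^sub>R m"
    using assms by (auto simp: cone_over_def in_segment)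
  have "inner_distance (cone_over 0 S) (0 *\<^sub>R p) (1 *\<^sub>R p) \<le> ennreal (norm p)"
  proof (rule inner_distance_le_lipschitz)
    show "(norm p)-lipschitz_on {0..1} (\<lambda>s. s *\<^sub>R p)"
      by (rule lipschitz_onI) (auto simp: dist_norm simp flip: scaleR_left_diff_distrib)
    have "s *\<^sub>R p \<in> closed_segment 0 m" if "s \<in> {0..1}" for s
      using that m by (auto simp: in_segment intro!: exI[of _ "s * l"] mult_le_one)
    then show "(\<lambda>s. s *\<^sub>R p) ` {0..1} \<subseteq> cone_over 0 S" using m by (auto simp: cone_over_def)
  qed
  then show ?thesis by simp
qed

section \<open>The choking horn\<close>

definition horn_circle :: "nat \<Rightarrow> real \<Rightarrow> real \<Rightarrow> complex ^ 3" where
  "horn_circle k t \<theta> = vector [of_real (t ^ k * cos \<theta>), of_real (t ^ k * sin \<theta>), of_real t]"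

lemma branch_horn_circle: "branch \<i> (horn_circle k t \<theta>) = of_real (t ^ k) * cis \<theta>"
  unfolding branch_def horn_circle_def
  by (simp add: cis.ctr Complex_eq algebra_simps)

lemma horn_circle_brieskorn: "horn_circle k t \<theta> \<in> brieskorn k"
proof -
  have "(t ^ k * cos \<theta>)\<^sup>2 + (t ^ k * sin \<theta>)\<^sup>2 = (t ^ k)\<^sup>2 * ((sin \<theta>)\<^sup>2 + (cos \<theta>)\<^sup>2)"
    by (simp only: power_mult_distrib distrib_left)
  also have "\<dots> = t ^ (2 * k)" by (simp add: mult.commute flip: power_mult)
  finally show ?thesis
    by (simp add: brieskorn_def horn_circle_def flip: of_real_mult of_real_power of_real_add)
qed

text \<open>On a simply connected D the map (u, v, z^k) after H lifts through the double covering.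
  The first component of the lift along \<gamma> would be a continuous square root of t^k cis
  \<theta>.\<close>

lemma horn_circle_not_in_simply_connected:
  fixes D :: "'a::real_normed_vector set" and H :: "'a \<Rightarrow> complex ^ 3"
  assumes D: "simply_connected D" "locally path_connected D"
    and H: "continuous_on D H" "H ` D \<subseteq> brieskorn k - {0}"
    and \<gamma>: "continuous_on {0..2 * pi} \<gamma>" "\<gamma> ` {0..2 * pi} \<subseteq> D" "\<gamma> (2 * pi) = \<gamma> 0"
    and H\<gamma>: "\<And>\<theta>. \<theta> \<in> {0..2 * pi} \<Longrightarrow> H (\<gamma> \<theta>) = horn_circle k t \<theta>"
    and t: "t \<noteq> 0" and k: "0 < k"
  shows False
proof -
  define G where "G x = (branch \<i> (H x), branch (-\<i>) (H x), (H x $ 3) ^ k)" for x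
  have "continuous_on D G" unfolding G_def by (intro continuous_intros H)
  moreover have "G \<in> D \<rightarrow> punctured_quadric"
  proof
    fix x assume "x \<in> D"
    then have "H x \<in> brieskorn k" "H x \<noteq> 0" using H by auto
    then show "G x \<in> punctured_quadric"
      using branch_nonzero[of \<i> "H x" k] k
      by (auto simp: G_def punctured_quadric_def brieskorn_iff[of \<i>] mult.commute simp flip: power_mult)
  qed
  ultimately obtain g where g: "continuous_on D g" "\<And>x. x \<in> D \<Longrightarrow> veronese (g x) = G x"
    using covering_space_lift[OF covering_space_veronese D] by blast
  show False
  proof (rule no_continuous_sqrt_on_circle)
    show "continuous_on {0..2 * pi} (\<lambda>\<theta>. fst (g (\<gamma> \<theta>)))"
      by (intro continuous_on_fst continuous_on_compose2[OF g(1) \<gamma>(1,2)])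
    show "fst (g (\<gamma> (2 * pi))) = fst (g (\<gamma> 0))" by (simp add: \<gamma>)
    show "of_real (t ^ k) \<noteq> (0::complex)" using t by simp
    fix \<theta> assume \<theta>: "\<theta> \<in> {0..2 * pi}"
    have "(fst q)\<^sup>2 = fst (veronese q)" for q by (simp add: veronese_def split: prod.split)
    also have "veronese (g (\<gamma> \<theta>)) = G (\<gamma> \<theta>)" using g(2) \<gamma>(2) \<theta> by blast
    finally show "(fst (g (\<gamma> \<theta>)))\<^sup>2 = of_real (t ^ k) * cis \<theta>"
      by (simp add: G_def H\<gamma>[OF \<theta>] branch_horn_circle)
  qed
qed

section \<open>Size of the horn circles and position of their preimages\<close>

lemma norm_horn_circle_le:
  assumes "0 \<le> t" "t \<le> 1" "0 < k"
  shows "norm (horn_circle k t \<theta>) \<le> 2 * t"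
proof -
  have "(norm (horn_circle k t \<theta>))\<^sup>2 = (t ^ k)\<^sup>2 * ((sin \<theta>)\<^sup>2 + (cos \<theta>)\<^sup>2) + t\<^sup>2"
    by (simp only: distrib_left) (simp add: norm_vec3 horn_circle_def power_mult_distrib del: of_real_mult of_real_power)
  also have "\<dots> \<le> t\<^sup>2 + t\<^sup>2"
    using assms power_decreasing[of 1 k t] by (simp add: power_mono)
  also have "\<dots> \<le> (2 * t)\<^sup>2" by (simp add: power_mult_distrib)
  finally show ?thesis by (rule power2_le_imp_le) (use assms in simp)
qed

lemma norm_horn_circle_ge: "\<bar>t\<bar> \<le> norm (horn_circle k t \<theta>)"
  using Finite_Cartesian_Product.norm_nth_le[of "horn_circle k t \<theta>" 3] by (simp add: horn_circle_def)

lemma horn_circle_nonzero: "t \<noteq> 0 \<Longrightarrow> horn_circle k t \<theta> \<noteq> 0"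
  using norm_horn_circle_ge[of t k \<theta>] by auto

text \<open>The factor 2 comes from bounding the norm by the sum of the coordinate moduli.\<close>

lemma dist_horn_circle_le:
  assumes "0 \<le> t" shows "dist (horn_circle k t a) (horn_circle k t b) \<le> 2 * t ^ k * \<bar>a - b\<bar>"
proof -
  have c: "\<bar>cos a - cos b\<bar> \<le> \<bar>a - b\<bar>"
  proof -
    have "\<bar>sin ((a + b) / 2)\<bar> * \<bar>sin ((b - a) / 2)\<bar> \<le> 1 * \<bar>(b - a) / 2\<bar>"
      by (intro mult_mono abs_sin_x_le_abs_x) auto
    then show ?thesis by (simp add: cos_diff_cos abs_mult)
  qed
  have s: "\<bar>sin a - sin b\<bar> \<le> \<bar>a - b\<bar>"
  proof -
    have "\<bar>sin ((a - b) / 2)\<bar> * \<bar>cos ((a + b) / 2)\<bar> \<le> \<bar>(a - b) / 2\<bar> * 1"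
      by (intro mult_mono abs_sin_x_le_abs_x) auto
    then show ?thesis by (simp add: sin_diff_sin abs_mult)
  qed
  have "dist (horn_circle k t a) (horn_circle k t b)
      \<le> (\<Sum>i\<in>UNIV. cmod ((horn_circle k t a - horn_circle k t b) $ i))"
    unfolding dist_norm norm_vec_def by (rule L2_set_le_sum) simp
  also have "\<dots> = t ^ k * \<bar>cos a - cos b\<bar> + t ^ k * \<bar>sin a - sin b\<bar>"
    using assms by (simp add: sum_3 horn_circle_def norm_mult abs_mult flip: right_diff_distrib of_real_diff of_real_mult)
  also have "\<dots> \<le> t ^ k * \<bar>a - b\<bar> + t ^ k * \<bar>a - b\<bar>"
    using c s assms by (intro add_mono mult_left_mono) auto
  finally show ?thesis by simp
qed

text \<open>The disc of radius |b| about b lies in the half-plane bounded by the line through 0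
  perpendicular to b. This turns closeness to b into membership in a sector.\<close>

lemma Re_cnj_mult_pos:
  fixes b d :: complex assumes "cmod (d - b) < cmod b"
  shows "0 < Re (cnj b * d)"
proof -
  have "Re (cnj b * d) = (cmod b)\<^sup>2 + Re (cnj b * (d - b))"
    unfolding cmod_power2 by (simp add: algebra_simps power2_eq_square)
  moreover have "\<bar>Re (cnj b * (d - b))\<bar> \<le> cmod b * cmod (d - b)"
    using abs_Re_le_cmod[of "cnj b * (d - b)"] by (simp add: norm_mult)
  moreover have "cmod b * cmod (d - b) < cmod b * cmod b"
    using assms norm_ge_zero[of "d - b"] by (intro mult_strict_left_mono) linarith+
  ultimately show ?thesis by (simp add: power2_eq_square)
qed

text \<open>If h fixes 0, the bi-Lipschitz bounds put the preimage of the circle at distance at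
  least t / L from the apex, with diameter of order L t^k. Some branch has size of order t there,
  which dominates t^k because k > 1.\<close>

lemma horn_circle_preimage_in_sector:
  assumes k: "1 < k" and e: "0 < \<epsilon>"
    and hom: "homeomorphism (cone_over 0 (brieskorn k \<inter> sphere 0 \<epsilon>)) (brieskorn k \<inter> cball 0 \<epsilon>) h h'"
    and bl: "inner_bilipschitz_on (cone_over 0 (brieskorn k \<inter> sphere 0 \<epsilon>)) (brieskorn k \<inter> cball 0 \<epsilon>) h"
  obtains t \<sigma> b where "0 < t" "t \<le> 1" "2 * t \<le> \<epsilon>" "\<sigma>\<^sup>2 = -1"
    "\<And>\<theta>. \<theta> \<in> {0..2 * pi} \<Longrightarrow> cmod (branch \<sigma> (h' (horn_circle k t \<theta>)) - b) < cmod b"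
proof -
  let ?X = "brieskorn k"
  let ?C = "cone_over 0 (?X \<inter> sphere 0 \<epsilon>)" and ?B = "?X \<inter> cball 0 \<epsilon>"
  have k0: "0 < k" using k by simp
  have ii: "\<i>\<^sup>2 = -1" "(-\<i>)\<^sup>2 = -1" by simp_all
  have circB: "horn_circle k t \<theta> \<in> ?B" if "0 < t" "t \<le> 1" "2 * t \<le> \<epsilon>" for t \<theta>
    using norm_horn_circle_le[of t k \<theta>] that k0 by (simp add: horn_circle_brieskorn)
  have zB: "0 \<in> ?B" using e k0 by (simp add: brieskorn_def)
  have h'C: "h' y \<in> ?C" "h (h' y) = y" if "y \<in> ?B" for y
    using hom that by (auto simp: homeomorphism_def)
  show thesis
  proof (cases "h' 0 = 0")
    case False
    let ?m = "(\<epsilon> / norm (h' 0)) *\<^sub>R h' 0"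
    have "?m \<in> ?X" using cone_over_sphere_iff[OF e False] h'C[OF zB] by blast
    moreover have "?m \<noteq> 0" using False e by simp
    ultimately obtain \<sigma> where \<sigma>: "\<sigma>\<^sup>2 = -1" "branch \<sigma> ?m \<noteq> 0"
      using branch_nonzero[of \<i> ?m k] k0 ii by blast
    define b where "b = branch \<sigma> (h' 0)"
    have b: "b \<noteq> 0" using \<sigma> by (auto simp: b_def branch_scaleR)
    have "continuous_on ?B h'" using hom by (simp add: homeomorphism_def)
    \<comment> \<open>Half of \<open>cmod b\<close> absorbs the factor 2 in
      \<open>norm_branch_le\<close>.\<close>
    then obtain d where d: "0 < d" "\<And>y. y \<in> ?B \<Longrightarrow> dist y 0 < d \<Longrightarrow> dist (h' y) (h' 0) < cmod b / 2"
      using zB b unfolding continuous_on_iff by (meson half_gt_zero zero_less_norm_iff)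
    define t where "t = min 1 (min (\<epsilon> / 2) (d / 3))"
    have t: "0 < t" "t \<le> 1" "2 * t \<le> \<epsilon>" "2 * t < d" using e d(1) by (auto simp: t_def)
    show thesis
    proof (rule that[OF t(1-3) \<sigma>(1)])
      fix \<theta>
      have "dist (horn_circle k t \<theta>) 0 < d" using norm_horn_circle_le[of t k \<theta>] t k0 by simp
      then have "norm (h' (horn_circle k t \<theta>) - h' 0) < cmod b / 2"
        using d(2)[OF circB[OF t(1-3)]] by (simp add: dist_norm)
      then show "cmod (branch \<sigma> (h' (horn_circle k t \<theta>)) - b) < cmod b"
        using norm_branch_le[OF \<sigma>(1), of "h' (horn_circle k t \<theta>) - h' 0"]
        by (simp add: b_def branch_diff)
    qed
  next
    case True
    obtain L where L: "0 < L"
      "\<And>x y. x \<in> ?C \<Longrightarrow> y \<in> ?C \<Longrightarrow> inner_distance ?B (h x) (h y) \<le> ennreal L * inner_distance ?C x y"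
      "\<And>x y. x \<in> ?C \<Longrightarrow> y \<in> ?C \<Longrightarrow> inner_distance ?C x y \<le> ennreal L * inner_distance ?B (h x) (h y)"
      using bl unfolding inner_bilipschitz_on_def by blast
    let ?M = "?X \<inter> sphere 0 \<epsilon>"
    \<comment> \<open>The two branches have no common zero on the link, which is compact, so the sum
      of their moduli has a positive minimum; for an empty link any positive number will do.\<close>
    obtain \<kappa> where \<kappa>: "0 < \<kappa>" "\<And>m. m \<in> ?M \<Longrightarrow> \<kappa> \<le> cmod (branch \<i> m) + cmod (branch (-\<i>) m)"
    proof (cases "?M = {}")
      case True
      then show ?thesis using that[of 1] by auto
    next
      case False
      have "closed ?X"
        unfolding brieskorn_def by (intro closed_Collect_eq continuous_intros)
      then have "compact ?M" by (intro closed_Int_compact compact_sphere)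
      moreover have "continuous_on ?M (\<lambda>m. cmod (branch \<i> m) + cmod (branch (-\<i>) m))"
        by (intro continuous_intros)
      ultimately obtain m0 where m0: "m0 \<in> ?M" "\<forall>m\<in>?M.
          cmod (branch \<i> m0) + cmod (branch (-\<i>) m0) \<le> cmod (branch \<i> m) + cmod (branch (-\<i>) m)"
        using continuous_attains_inf[OF _ False] by blast
      have "0 < cmod (branch \<i> m0) + cmod (branch (-\<i>) m0)"
        using branch_nonzero[OF ii(1), of m0 k] m0(1) e k0
        by (auto simp: add_pos_nonneg add_nonneg_pos)
      then show ?thesis using that m0(2) by blast
    qed
    \<comment> \<open>The bound \<epsilon> / 2 keeps the circle in the ball, as its norm is at most
      2 t. The last bound yields twice the estimate required in \<open>tk\<close>, which makes that
      inequality strict.\<close>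
    define t where "t = min 1 (min (\<epsilon> / 2) (\<kappa> / (32 * pi * \<epsilon> * L\<^sup>2)))"
    have t: "0 < t" "t \<le> 1" "2 * t \<le> \<epsilon>" using e \<kappa>(1) L(1) by (auto simp: t_def)
    have tk: "8 * pi * L * t ^ k < \<kappa> * t / (2 * \<epsilon> * L)"
    proof -
      have "t \<le> \<kappa> / (32 * pi * \<epsilon> * L\<^sup>2)" by (simp add: t_def)
      then have "16 * pi * L * t \<le> \<kappa> / (2 * \<epsilon> * L)"
        using e L(1) by (simp add: field_simps power2_eq_square)
      then have "16 * pi * L * t * t \<le> \<kappa> * t / (2 * \<epsilon> * L)"
        using t(1) by (metis mult_right_mono less_imp_le times_divide_eq_left)
      moreover have "t ^ k \<le> t * t"
        using power_decreasing[of 2 k t] t k by (simp add: power2_eq_square)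
      then have "8 * pi * L * t ^ k \<le> 8 * pi * L * (t * t)"
        using L(1) by (intro mult_left_mono) auto
      moreover have "0 < 8 * pi * L * (t * t)" using L(1) t by simp
      ultimately show ?thesis by linarith
    qed
    define p where "p = h' (horn_circle k t 0)"
    have pC: "p \<in> ?C" and hp: "h p = horn_circle k t 0"
      using h'C[OF circB[OF t]] by (simp_all add: p_def)
    have zC: "0 \<in> ?C" and h0: "h 0 = 0" using h'C[OF zB] True by simp_all
    \<comment> \<open>The circle is at distance at least t from 0 = \<open>h 0\<close>, and the
      inner distance from the apex to p is at most \<open>norm p\<close>.\<close>
    have tp: "t \<le> L * norm p"
    proof -
      have "ennreal t \<le> ennreal (dist (h 0) (h p))"
        using norm_horn_circle_ge[of t k 0] t by (simp add: h0 hp ennreal_leI)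
      also have "\<dots> \<le> inner_distance ?B (h 0) (h p)" by (rule dist_le_inner_distance)
      also have "\<dots> \<le> ennreal L * inner_distance ?C 0 p" by (rule L(2)[OF zC pC])
      also have "\<dots> \<le> ennreal L * ennreal (norm p)"
        by (intro mult_left_mono inner_distance_apex_le[OF pC]) simp
      finally show ?thesis using L(1) by (simp flip: ennreal_mult)
    qed
    then have p0: "p \<noteq> 0" using t by auto
    let ?m = "(\<epsilon> / norm p) *\<^sub>R p"
    have "?m \<in> ?M" using cone_over_sphere_iff[OF e p0] pC p0 e by auto
    then have "\<kappa> \<le> cmod (branch \<i> ?m) + cmod (branch (-\<i>) ?m)" by (rule \<kappa>(2))
    \<comment> \<open>One of the two branches carries at least half of the sum. Scaling from the
      link back to p then gives the lower bound for \<open>cmod b\<close>.\<close>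
    then have "\<kappa> / 2 \<le> cmod (branch \<i> ?m) \<or> \<kappa> / 2 \<le> cmod (branch (-\<i>) ?m)" by linarith
    then obtain \<sigma> where \<sigma>: "\<sigma>\<^sup>2 = -1" "\<kappa> / 2 \<le> cmod (branch \<sigma> ?m)" using ii by blast
    define b where "b = branch \<sigma> p"
    have "\<kappa> / 2 \<le> \<epsilon> / norm p * cmod b"
      using \<sigma>(2) e by (simp add: branch_scaleR norm_mult norm_divide b_def)
    then have "\<kappa> * norm p \<le> 2 * \<epsilon> * cmod b" using p0 by (simp add: field_simps)
    then have "\<kappa> * (L * norm p) \<le> 2 * \<epsilon> * L * cmod b"
      using mult_left_mono[of "\<kappa> * norm p" _ L] L(1) by (simp add: algebra_simps)
    then have "\<kappa> * t \<le> 2 * \<epsilon> * L * cmod b"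
      using mult_left_mono[OF tp, of \<kappa>] \<kappa>(1) by linarith
    then have b: "\<kappa> * t / (2 * \<epsilon> * L) \<le> cmod b" using e L(1) by (simp add: field_simps)
    show thesis
    proof (rule that[OF t \<sigma>(1)])
      fix \<theta> :: real assume \<theta>: "\<theta> \<in> {0..2 * pi}"
      define q where "q = h' (horn_circle k t \<theta>)"
      have qC: "q \<in> ?C" and hq: "h q = horn_circle k t \<theta>"
        using h'C[OF circB[OF t]] by (simp_all add: q_def)
      \<comment> \<open>The arc of the circle from angle 0 to \<theta> joins the two points inside
        the surface; the factors 0 and 1 match the endpoints of its parametrisation on the unit
        interval.\<close>
      have "inner_distance ?B (horn_circle k t (0 * \<theta>)) (horn_circle k t (1 * \<theta>))
          \<le> ennreal (4 * pi * t ^ k)"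
      proof (rule inner_distance_le_lipschitz)
        show "(4 * pi * t ^ k)-lipschitz_on {0..1} (\<lambda>s. horn_circle k t (s * \<theta>))"
        proof (rule lipschitz_onI)
          fix x y :: real
          have "dist (horn_circle k t (x * \<theta>)) (horn_circle k t (y * \<theta>)) \<le> 2 * t ^ k * \<bar>x * \<theta> - y * \<theta>\<bar>"
            using t by (intro dist_horn_circle_le) simp
          also have "\<bar>x * \<theta> - y * \<theta>\<bar> = \<theta> * dist x y"
            using \<theta> by (simp add: dist_real_def abs_mult flip: left_diff_distrib)
          also have "2 * t ^ k * (\<theta> * dist x y) \<le> 2 * t ^ k * (2 * pi * dist x y)"
            using \<theta> t by (intro mult_left_mono mult_right_mono) auto
          finally show "dist (horn_circle k t (x * \<theta>)) (horn_circle k t (y * \<theta>)) \<le> 4 * pi * t ^ k * dist x y"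
            by (simp add: algebra_simps)
        qed (use t in simp)
        show "(\<lambda>s. horn_circle k t (s * \<theta>)) ` {0..1} \<subseteq> ?B" using circB[OF t] by blast
      qed
      then have "ennreal L * inner_distance ?B (h p) (h q) \<le> ennreal L * ennreal (4 * pi * t ^ k)"
        by (intro mult_left_mono) (simp_all add: hp hq)
      then have "ennreal (dist p q) \<le> ennreal L * ennreal (4 * pi * t ^ k)"
        using dist_le_inner_distance[of p q ?C] L(3)[OF pC qC] by order
      then have "dist p q \<le> L * (4 * pi * t ^ k)"
        using L(1) t by (simp flip: ennreal_mult)
      then have "cmod (branch \<sigma> (q - p)) \<le> 8 * pi * L * t ^ k"
        using norm_branch_le[OF \<sigma>(1), of "q - p"] by (simp add: dist_norm norm_minus_commute algebra_simps)
      then show "cmod (branch \<sigma> (h' (horn_circle k t \<theta>)) - b) < cmod b"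
        using tk b by (simp add: b_def q_def branch_diff)
    qed
  qed
qed

lemma brieskorn_not_strongly_metrically_conic:
  assumes k: "1 < k"
  shows "\<not> strongly_metrically_conic (brieskorn k) 0"
proof
  assume "strongly_metrically_conic (brieskorn k) 0"
  \<comment> \<open>Positivity of the radius joins the eventual property; a single such radius leads
    to a contradiction.\<close>
  then have "\<forall>\<^sub>F \<epsilon> in at_right 0. \<exists>h h'. 0 < \<epsilon> \<and>
      homeomorphism (cone_over 0 (brieskorn k \<inter> sphere 0 \<epsilon>)) (brieskorn k \<inter> cball 0 \<epsilon>) h h' \<and>
      inner_bilipschitz_on (cone_over 0 (brieskorn k \<inter> sphere 0 \<epsilon>)) (brieskorn k \<inter> cball 0 \<epsilon>) h"
    unfolding strongly_metrically_conic_def using eventually_at_right_less[of 0]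
    by eventually_elim blast
  then obtain \<epsilon> h h' where e: "0 < \<epsilon>"
    and hom: "homeomorphism (cone_over 0 (brieskorn k \<inter> sphere 0 \<epsilon>)) (brieskorn k \<inter> cball 0 \<epsilon>) h h'"
    and bl: "inner_bilipschitz_on (cone_over 0 (brieskorn k \<inter> sphere 0 \<epsilon>)) (brieskorn k \<inter> cball 0 \<epsilon>) h"
    using eventually_happens'[OF trivial_limit_at_right_real] by blast
  let ?C = "cone_over 0 (brieskorn k \<inter> sphere 0 \<epsilon>)" and ?B = "brieskorn k \<inter> cball 0 \<epsilon>"
  obtain t \<sigma> b where t: "0 < t" "t \<le> 1" "2 * t \<le> \<epsilon>" and \<sigma>: "\<sigma>\<^sup>2 = -1"
    and near: "\<And>\<theta>. \<theta> \<in> {0..2 * pi} \<Longrightarrow> cmod (branch \<sigma> (h' (horn_circle k t \<theta>)) - b) < cmod b"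
    using horn_circle_preimage_in_sector[OF k e hom bl] by metis
  have b: "cnj b \<noteq> 0" using near[of 0] by auto
  \<comment> \<open>Removing \<open>h' 0\<close> from the sector makes h map it into the surface
    minus 0.\<close>
  let ?D = "{p \<in> ?C. 0 < Re (cnj b * branch \<sigma> p)} - {h' 0}"
  have circB: "horn_circle k t \<theta> \<in> ?B" for \<theta>
    using norm_horn_circle_le[of t k \<theta>] t k by (simp add: horn_circle_brieskorn)
  have zB: "0 \<in> ?B" using e k by (simp add: brieskorn_def)
  have h'C: "h' y \<in> ?C" "h (h' y) = y" if "y \<in> ?B" for y
    using hom that by (auto simp: homeomorphism_def)
  have hC: "h x \<in> ?B" "h' (h x) = x" if "x \<in> ?C" for x
    using hom that by (auto simp: homeomorphism_def)
  show False
  proof (rule horn_circle_not_in_simply_connected)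
    have "convex ((UNIV \<times> UNIV \<times> {0<..1}) :: (real \<times> complex \<times> real) set)"
      by (intro convex_Times) auto
    then show "simply_connected ?D" "locally path_connected ?D"
      using punctured_homeomorphic_convex[OF cone_chart[OF \<sigma> b _ e]] k
      by (simp_all add: aff_dim_chart)
    show "continuous_on ?D h"
      using hom by (auto simp: homeomorphism_def intro: continuous_on_subset)
    show "h ` ?D \<subseteq> brieskorn k - {0}"
      using hC by force
    have "continuous_on {0..2 * pi} (horn_circle k t)"
      unfolding horn_circle_def by (intro continuous_intros)
    then show "continuous_on {0..2 * pi} (\<lambda>\<theta>. h' (horn_circle k t \<theta>))"
      using hom circB by (auto simp: homeomorphism_def intro!: continuous_on_compose2[of ?B h'])
    show "(\<lambda>\<theta>. h' (horn_circle k t \<theta>)) ` {0..2 * pi} \<subseteq> ?D"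
    proof clarify
      fix \<theta> :: real assume \<theta>: "\<theta> \<in> {0..2 * pi}"
      have "h' (horn_circle k t \<theta>) \<noteq> h' 0"
        using h'C(2)[OF circB[of \<theta>]] h'C(2)[OF zB] horn_circle_nonzero[of t k \<theta>] t(1) by force
      then show "h' (horn_circle k t \<theta>) \<in> ?D"
        using h'C(1)[OF circB] Re_cnj_mult_pos[OF near[OF \<theta>]] by blast
    qed
    show "h' (horn_circle k t (2 * pi)) = h' (horn_circle k t 0)" by (simp add: horn_circle_def)
    show "h (h' (horn_circle k t \<theta>)) = horn_circle k t \<theta>" for \<theta> by (rule h'C(2)[OF circB])
    show "t \<noteq> 0" "0 < k" using t k by auto
  qed
qed

section \<open>The singular point\<close>

text \<open>The difference quotients of \<phi> along \<gamma> lie in E, and a subspace of a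
  finite-dimensional space is closed, so their limit lies in E.\<close>

lemma tangent_vector_in_subspace:
  fixes E :: "'b::euclidean_space set" and \<gamma> :: "real \<Rightarrow> 'a::real_normed_vector"
  assumes \<phi>: "(\<phi> has_derivative f') (at (\<gamma> 0))"
    and \<gamma>: "(\<gamma> has_vector_derivative w) (at 0)"
    and U: "open U" "\<gamma> 0 \<in> U"
    and E: "subspace E" "\<And>s. \<gamma> s \<in> U \<Longrightarrow> \<phi> (\<gamma> s) \<in> E"
  shows "f' w \<in> E"
proof -
  have "((\<phi> \<circ> \<gamma>) has_vector_derivative f' w) (at 0)"
    by (rule vector_derivative_diff_chain_within[OF \<gamma> has_derivative_at_withinI[OF \<phi>]])
  then have "((\<phi> \<circ> \<gamma>) has_derivative (\<lambda>s. s *\<^sub>R f' w)) (at_right 0)"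
    by (simp add: has_vector_derivative_def has_derivative_at_withinI)
  then have "((\<lambda>s. (1 / norm (s - 0)) *\<^sub>R (\<phi> (\<gamma> s) - (\<phi> (\<gamma> 0) + (s - 0) *\<^sub>R f' w))) \<longlongrightarrow> 0) (at_right 0)"
    unfolding has_derivative_within comp_def by blast
  \<comment> \<open>Adding \<open>f' w\<close> to the normalised remainder recovers the difference
    quotient, since \<open>norm (s - 0) = s\<close> to the right of 0.\<close>
  then have "((\<lambda>s. (1 / norm (s - 0)) *\<^sub>R (\<phi> (\<gamma> s) - (\<phi> (\<gamma> 0) + (s - 0) *\<^sub>R f' w)) + f' w)
      \<longlongrightarrow> 0 + f' w) (at_right 0)"
    by (intro tendsto_add tendsto_const)
  moreover have "isCont \<gamma> 0" using \<gamma> by (rule has_vector_derivative_continuous)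
  then have "\<forall>\<^sub>F s in at_right 0. \<gamma> s \<in> U"
    using U by (auto simp: isCont_def intro: topological_tendstoD filterlim_at_within_If tendsto_within_subset)
  then have "\<forall>\<^sub>F s in at_right 0. (1 / norm (s - 0)) *\<^sub>R (\<phi> (\<gamma> s) - (\<phi> (\<gamma> 0) + (s - 0) *\<^sub>R f' w)) + f' w \<in> E"
    using eventually_at_right_less[of 0]
  proof eventually_elim
    case (elim s)
    have "(1 / s) *\<^sub>R (\<phi> (\<gamma> s) - \<phi> (\<gamma> 0)) \<in> E"
      using E U elim by (intro subspace_scale subspace_diff) auto
    then show ?case using elim by (simp add: algebra_simps)
  qed
  ultimately have "0 + f' w \<in> E"
    by (rule Lim_in_closed_set[OF closed_subspace[OF E(1)] _ trivial_limit_at_right_real, rotated])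
  then show ?thesis by simp
qed

lemma brieskorn_singular_point:
  assumes k: "1 < k"
  shows "singular_point (brieskorn k) 0"
  unfolding singular_point_def
proof (intro conjI notI)
  show "0 \<in> brieskorn k" using k by (simp add: brieskorn_def)
  assume "\<exists>U V \<phi> \<psi> E. open U \<and> 0 \<in> U \<and> open V \<and> homeomorphism U V \<phi> \<psi> \<and>
          holomorphic_map_on U \<phi> \<and> holomorphic_map_on V \<psi> \<and>
          vec.subspace (E :: (complex ^ 3) set) \<and> \<phi> ` (brieskorn k \<inter> U) = E \<inter> V"
  then obtain U V \<phi> \<psi> E where U: "open U" "0 \<in> U" and V: "open V" and hom: "homeomorphism U V \<phi> \<psi>"
    and hol: "holomorphic_map_on U \<phi>" "holomorphic_map_on V \<psi>"
    and E: "vec.subspace (E :: (complex ^ 3) set)" and XE: "\<phi> ` (brieskorn k \<inter> U) = E \<inter> V"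
    by blast
  obtain f' where f': "(\<phi> has_derivative f') (at 0)" "\<And>c v. f' (c *s v) = c *s f' v"
    using hol(1) U(2) unfolding holomorphic_map_on_def by blast
  have "\<phi> 0 \<in> V" using hom U(2) by (auto simp: homeomorphism_def)
  then obtain g' where g': "(\<psi> has_derivative g') (at (\<phi> 0))"
    using hol(2) unfolding holomorphic_map_on_def by blast
  \<comment> \<open>The chain rule for the inverse pair makes \<open>f'\<close> injective, hence
    surjective by equality of dimensions.\<close>
  have "((\<psi> \<circ> \<phi>) has_derivative g' \<circ> f') (at 0)" by (rule diff_chain_at[OF f'(1) g'])
  then have "(id has_derivative g' \<circ> f') (at 0)"
    by (rule has_derivative_transform_within_open[OF _ U]) (use hom in \<open>simp add: homeomorphism_apply1\<close>)
  then have "g' \<circ> f' = id" using has_derivative_unique[OF _ has_derivative_id] by blast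
  then have inj: "inj f'" by (metis inj_on_id inj_on_imageI2)
  have lin: "linear f'" using f'(1) by (rule has_derivative_linear)
  have "surj f'" by (rule linear_injective_imp_surjective[OF lin inj]) simp
  \<comment> \<open>Real scalars act as complex ones, so the complex subspace E is also a real
    subspace.\<close>
  have "c *\<^sub>R v = of_real c *s v" for c and v :: "complex ^ 3"
    unfolding vec_eq_iff vector_scaleR_component vector_smult_component by (simp add: scaleR_conv_of_real)
  then have "subspace E"
    using E by (simp add: subspace_def vec.subspace_def)
  then have tangent: "f' w \<in> E"
    if "(\<gamma> has_vector_derivative w) (at 0)" "\<gamma> 0 = 0" "\<And>s. \<gamma> s \<in> brieskorn k" for \<gamma> w
    using tangent_vector_in_subspace[of \<phi> f' \<gamma> w U E] f'(1) U that XE by auto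
  let ?w1 = "vector [1, \<i>, 0] :: complex ^ 3" and ?w2 = "vector [1, -\<i>, 0] :: complex ^ 3"
    and ?w3 = "vector [0, 0, 1] :: complex ^ 3"
  \<comment> \<open>These lines lie in the surface, as 1 + s^2 = 0 and the third coordinate
    vanishes.\<close>
  have w12: "f' (vector [1, s, 0]) \<in> E" if "s\<^sup>2 = -1" for s
  proof (rule tangent[of "\<lambda>x. x *\<^sub>R vector [1, s, 0]"])
    show "((\<lambda>x. x *\<^sub>R vector [1, s, 0]) has_vector_derivative vector [1, s, 0]) (at 0)"
      by (auto intro!: derivative_eq_intros)
    show "x *\<^sub>R vector [1, s, 0] \<in> brieskorn k" for x
      unfolding brieskorn_def mem_Collect_eq vector_scaleR_component
      using that k by (simp add: scaleR_conv_of_real power_mult_distrib)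
  qed simp
  have w3: "f' ?w3 \<in> E"
  \<comment> \<open>The curve (x^k, 0, x) has tangent (0, 0, 1) at 0 because k > 1.\<close>
  proof (rule tangent[of "\<lambda>x. x ^ k *\<^sub>R axis 1 1 + x *\<^sub>R ?w3"])
    show "((\<lambda>x. x ^ k *\<^sub>R axis 1 1 + x *\<^sub>R ?w3) has_vector_derivative ?w3) (at 0)"
      using k by (auto intro!: derivative_eq_intros)
    show "x ^ k *\<^sub>R axis 1 1 + x *\<^sub>R ?w3 \<in> brieskorn k" for x
      unfolding brieskorn_def mem_Collect_eq vector_add_component vector_scaleR_component
      by (simp add: scaleR_conv_of_real axis_def mult.commute[of 2] power_mult)
  qed (use k in simp)
  have "f' v \<in> E" for v
  proof -
    have "v = ((v $ 1 - \<i> * v $ 2) / 2) *s ?w1 + ((v $ 1 + \<i> * v $ 2) / 2) *s ?w2 + v $ 3 *s ?w3"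
      by (simp add: vec_eq_iff forall_3 field_simps)
    then have "f' v = ((v $ 1 - \<i> * v $ 2) / 2) *s f' ?w1 + ((v $ 1 + \<i> * v $ 2) / 2) *s f' ?w2 + v $ 3 *s f' ?w3"
      by (metis f'(2) linear_add[OF lin])
    then show ?thesis
      using w12[of \<i>] w12[of "-\<i>"] w3 E by (simp add: vec.subspace_add vec.subspace_scale)
  qed
  then have "E = UNIV" using \<open>surj f'\<close> by (metis UNIV_eq_I surjD)
  then have "\<phi> ` (brieskorn k \<inter> U) = \<phi> ` U" using XE hom by (simp add: homeomorphism_def)
  moreover have "inj_on \<phi> U" using hom by (auto simp: homeomorphism_def intro: inj_on_inverseI)
  ultimately have "brieskorn k \<inter> U = U" by (metis inf_le2 inj_on_image_eq_iff order_refl)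
  moreover obtain d where d: "0 < d" "ball 0 d \<subseteq> U" using U open_contains_ball by blast
  \<comment> \<open>The point (d / 2, 0, 0) lies in the ball but not on the surface, whose equation
    with z = 0 and y = 0 gives x = 0.\<close>
  let ?p = "(d / 2) *\<^sub>R (axis 1 1 :: complex ^ 3)"
  have "norm (axis 1 1 :: complex ^ 3) = 1" by (simp add: norm_vec_def L2_set_def sum_3 axis_def)
  then have "?p \<in> U" using d by (auto simp: subset_eq)
  moreover have "?p \<notin> brieskorn k"
    unfolding brieskorn_def mem_Collect_eq vector_scaleR_component
    using d k by (simp add: axis_def scaleR_conv_of_real power_0_left)
  ultimately show False by blast
qed

theorem theorem6p1:
  fixes k :: nat and X :: "(complex ^ 3) set"
  assumes "k > 2"
    and "X = {p. (p $ 1)\<^sup>2 + (p $ 2)\<^sup>2 = (p $ 3) ^ (2 * k)}"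
  shows "singular_point X 0 \<and> \<not> strongly_metrically_conic X 0"
proof -
  have "X = brieskorn k" "1 < k" using assms by (auto simp: brieskorn_def)
  then show ?thesis
    using brieskorn_singular_point brieskorn_not_strongly_metrically_conic by blast
qed

end
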